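(* Let $X$ be a locally compact Hausdorff space with Borel sigma-algebra $\mathcal B$, let $\sigma:X\to X$ be a measurable map which is onto, let $R$ be a $\sigma$-transfer operator on $\mathcal M(X,\mathcal B)$, let $\lambda$ be a probability measure on $(X,\mathcal B)$, and let $h\ge 0$ be a measurable function on $X$ with $\int_X h\,d\lambda=1$. Assume $Rh=h$. Then there exists a unique probability measure $\mathbb P$ on the cylinder sigma-algebra of the solenoid ${\rm Sol}_\sigma(X)$ such that $$\int_{{\rm Sol}_\sigma(X)}(f_0\circ\pi_0)(\omega)(f_1\circ\pi_1)(\omega)\cdots(f_n\circ\pi_n)(\omega)\,d\mathbb P(\omega)=\int_X f_0(x)\,\Big(R\big(f_1R(f_2\cdots R(f_nh)\cdots)\big)\Big)(x)\,d\lambda(x)$$ for all $n\in\mathbb N_0$ and all $f_0,\ldots,f_n\in\mathcal M(X,\mathcal B)$. (For $n=0$ the right side is $\int_X f_0h\,d\lambda$. In the normalized case $R1=1$ one uses $h\equiv 1$.)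
   Context: $\mathcal M(X,\mathcal B)$ is the space of real-valued measurable functions on $X$; integral identities are understood for functions for which they make sense (e.g. all $f_i$ bounded, or all nonnegative). A $\sigma$-transfer operator (Ruelle operator) is a linear map $R:\mathcal M(X,\mathcal B)\to\mathcal M(X,\mathcal B)$ such that $Rf\ge0$ whenever $f\ge 0$, and such that the pull-out property $R((f\circ\sigma)g)=fR(g)$ holds for all $f,g\in\mathcal M(X,\mathcal B)$. The solenoid is $${\rm Sol}_\sigma(X)=\{(x_k)_{k\in\mathbb N_0}\in X^{\mathbb N_0}:\ \sigma(x_{k+1})=x_k,\ k=0,1,\ldots\},$$ $\pi_k(x_0,x_1,\ldots)=x_k$ are the coordinate maps, and the cylinder sigma-algebra on ${\rm Sol}_\sigma(X)$ is the one generated by the $\pi_k$, $k\in\mathbb N_0$. *)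

theory Defs
  imports "HOL-Probability.Probability"
begin

text \<open>
  The space of real-valued Borel functions is \<open>borel_measurable borel\<close>. Since HOL functions are
  total, an operator on it is a function on all of \<open>'a \<Rightarrow> real\<close> whose values outside this space
  are irrelevant.
\<close>

definition linear_on_measurable ::
  "(('a::topological_space \<Rightarrow> real) \<Rightarrow> ('a \<Rightarrow> real)) \<Rightarrow> bool" where
  "linear_on_measurable R \<longleftrightarrow>
     (\<forall>f \<in> borel_measurable borel. R f \<in> borel_measurable borel) \<and>
     (\<forall>f \<in> borel_measurable borel. \<forall>g \<in> borel_measurable borel.
        R (\<lambda>x. f x + g x) = (\<lambda>x. R f x + R g x)) \<and>
     (\<forall>c. \<forall>f \<in> borel_measurable borel. R (\<lambda>x. c * f x) = (\<lambda>x. c * R f x))"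

definition transfer_operator ::
  "('a::topological_space \<Rightarrow> 'a) \<Rightarrow> (('a \<Rightarrow> real) \<Rightarrow> ('a \<Rightarrow> real)) \<Rightarrow> bool" where
  "transfer_operator \<sigma> R \<longleftrightarrow>
     linear_on_measurable R \<and>
     (\<forall>f \<in> borel_measurable borel. (\<forall>x. 0 \<le> f x) \<longrightarrow> (\<forall>x. 0 \<le> R f x)) \<and>
     (\<forall>f \<in> borel_measurable borel. \<forall>g \<in> borel_measurable borel.
        R (\<lambda>x. f (\<sigma> x) * g x) = (\<lambda>x. f x * R g x))"

definition solenoid :: "('a \<Rightarrow> 'a) \<Rightarrow> (nat \<Rightarrow> 'a) set" where
  "solenoid \<sigma> = {\<omega>. \<forall>k. \<sigma> (\<omega> (Suc k)) = \<omega> k}"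

text \<open>
  Only the underlying set and the sigma-algebra of this measure matter; its measure function is 0.
\<close>

definition solenoid_space :: "('a::topological_space \<Rightarrow> 'a) \<Rightarrow> (nat \<Rightarrow> 'a) measure" where
  "solenoid_space \<sigma> =
     sigma (solenoid \<sigma>) {(\<lambda>\<omega>. \<omega> k) -` A \<inter> solenoid \<sigma> | k A. A \<in> sets borel}"

text \<open>\<open>nested_transfer R h [f1, \<dots>, fn] = R (f1 R (f2 \<dots> R (fn h) \<dots>))\<close>\<close>

primrec nested_transfer ::
  "(('a \<Rightarrow> real) \<Rightarrow> ('a \<Rightarrow> real)) \<Rightarrow> ('a \<Rightarrow> real) \<Rightarrow> ('a \<Rightarrow> real) list \<Rightarrow> 'a \<Rightarrow> real" where
  "nested_transfer R h [] = h"
| "nested_transfer R h (f # fs) = R (\<lambda>x. f x * nested_transfer R h fs x)"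

text \<open>
  The path-space identity, for those \<open>f 0, \<dots>, f n\<close> for which the integrals make sense:
  as an equality in \<open>[0, \<infinity>]\<close> if all \<open>f k\<close> are nonnegative, and as an equality of real numbers
  if the integrand on the solenoid is integrable (in particular if all \<open>f k\<close> are bounded and
  \<open>P\<close> is a probability measure). Integrability on the base is part of the claim, because
  \<open>integral\<^sup>L\<close> is 0 on non-integrable functions.
\<close>

definition path_space_identity ::
  "(('a::topological_space \<Rightarrow> real) \<Rightarrow> ('a \<Rightarrow> real)) \<Rightarrow> ('a \<Rightarrow> real) \<Rightarrow> 'a measure \<Rightarrow>
   (nat \<Rightarrow> 'a) measure \<Rightarrow> nat \<Rightarrow> (nat \<Rightarrow> 'a \<Rightarrow> real) \<Rightarrow> bool" where
  "path_space_identity R h \<mu> P n f \<longleftrightarrow>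
     (let L = (\<lambda>\<omega>. \<Prod>k\<le>n. f k (\<omega> k));
          S = (\<lambda>x. f 0 x * nested_transfer R h (map f [1..<Suc n]) x)
      in ((\<forall>k\<le>n. \<forall>x. 0 \<le> f k x) \<longrightarrow>
            (\<integral>\<^sup>+ \<omega>. ennreal (L \<omega>) \<partial>P) = (\<integral>\<^sup>+ x. ennreal (S x) \<partial>\<mu>)) \<and>
         (integrable P L \<longrightarrow>
            integrable \<mu> S \<and> (\<integral>\<omega>. L \<omega> \<partial>P) = (\<integral>x. S x \<partial>\<mu>)))"

end

theory Submission
  imports Defs
begin

text \<open>
  A path of the solenoid is determined up to time \<open>n\<close> by its coordinate \<open>\<omega> n\<close>, because
  \<open>\<omega> k = (\<sigma> ^^ (n - k)) (\<omega> n)\<close>. By the pull-out property the identity for \<open>f 0, \<dots>, f n\<close> therefore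
  says only that \<open>\<integral> F (\<omega> n) \<partial>P = \<integral> (R ^^ n) (F h) \<partial>\<mu>\<close> for \<open>F = \<Prod>k\<le>n. f k \<circ> \<sigma> ^^ (n - k)\<close>
  (lemma \<open>nested_transfer_eq_push\<close>). So the law of every coordinate is prescribed. These laws are
  consistent since \<open>R h = h\<close>, and they determine \<open>P\<close> because the cylinders over single coordinates
  form an algebra that generates the sigma-algebra of the solenoid.

  For existence, the prescribed content on that algebra has to be continuous at the empty set.
  The measure \<open>\<mu>\<close> need not be regular, and the product sigma-algebra need not
  contain the solenoid, so neither inner approximation by compact sets nor restriction of a measure
  on the full product serves here. The proof uses instead two features of \<open>R\<close>.

  First, \<open>R\<close> is automatically sigma-continuous (\<open>transfer_operator_tendsto_0\<close>): a positive operator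
  that is defined on \<^emph>\<open>all\<close> real-valued measurable functions can be applied to the sum of a
  sequence that vanishes eventually at each point, and this bounds the terms of the sequence.

  Second, points are Borel, so the pull-out property concentrates \<open>R\<close> at \<open>x\<close> on the fibre
  \<open>\<sigma> -` {x}\<close>. Together with sigma-continuity this gives \<open>transfer_operator_fibre_witness\<close>: if
  \<open>R (u n)\<close> does not tend to 0 at \<open>x\<close>, then \<open>u n\<close> does not tend to 0 at some point above
  \<open>x\<close>. Iterating, a decreasing sequence of cylinders whose contents stay away from 0 yields
  points \<open>x 0, x 1, \<dots>\<close> with \<open>\<sigma> (x (k + 1)) = x k\<close>, that is, a path of the solenoid lying in
  all of them (\<open>mass_tendsto_0\<close>). Caratheodory's extension theorem then provides \<open>P\<close>.
\<close>

section \<open>Transfer operators\<close>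

lemma transfer_operator_measurable:
  assumes "transfer_operator \<sigma> R" "f \<in> borel_measurable borel"
  shows "R f \<in> borel_measurable borel"
  using assms unfolding transfer_operator_def linear_on_measurable_def by blast

lemma transfer_operator_add:
  assumes "transfer_operator \<sigma> R" "f \<in> borel_measurable borel" "g \<in> borel_measurable borel"
  shows "R (\<lambda>x. f x + g x) = (\<lambda>x. R f x + R g x)"
  using assms unfolding transfer_operator_def linear_on_measurable_def by blast

lemma transfer_operator_scale:
  assumes "transfer_operator \<sigma> R" "f \<in> borel_measurable borel"
  shows "R (\<lambda>x. c * f x) = (\<lambda>x. c * R f x)"
  using assms unfolding transfer_operator_def linear_on_measurable_def by blast

lemma transfer_operator_nonneg:
  assumes "transfer_operator \<sigma> R" "f \<in> borel_measurable borel" "\<And>x. 0 \<le> f x"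
  shows "0 \<le> R f x"
  using assms unfolding transfer_operator_def by blast

lemma transfer_operator_pull_out:
  assumes "transfer_operator \<sigma> R" "f \<in> borel_measurable borel" "g \<in> borel_measurable borel"
  shows "R (\<lambda>x. f (\<sigma> x) * g x) = (\<lambda>x. f x * R g x)"
  using assms unfolding transfer_operator_def by blast

lemma transfer_operator_diff:
  assumes R: "transfer_operator \<sigma> R"
    and [measurable]: "f \<in> borel_measurable borel" "g \<in> borel_measurable borel"
  shows "R (\<lambda>x. f x - g x) = (\<lambda>x. R f x - R g x)"
proof -
  have "R (\<lambda>x. f x + (-1) * g x) = (\<lambda>x. R f x + R (\<lambda>x. (-1) * g x) x)"
    by (rule transfer_operator_add[OF R]) measurable
  then show ?thesis
    using transfer_operator_scale[OF R, of g "-1"] by simp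
qed

lemma transfer_operator_mono:
  assumes R: "transfer_operator \<sigma> R"
    and f: "f \<in> borel_measurable borel" and g: "g \<in> borel_measurable borel"
    and le: "\<And>x. f x \<le> g x"
  shows "R f x \<le> R g x"
proof -
  have "0 \<le> R (\<lambda>x. g x - f x) x"
    using le f g by (intro transfer_operator_nonneg[OF R]) auto
  then show ?thesis
    by (simp add: transfer_operator_diff[OF R g f])
qed

lemma transfer_operator_sum:
  assumes R: "transfer_operator \<sigma> R"
    and f[measurable]: "\<And>i. f i \<in> borel_measurable borel"
  shows "R (\<lambda>x. \<Sum>i<(n::nat). f i x) x = (\<Sum>i<n. R (f i) x)"
proof (induction n)
  case 0
  show ?case
    using transfer_operator_scale[OF R, of "\<lambda>_. 0" 0] by (simp add: fun_eq_iff)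
next
  case (Suc n)
  have "R (\<lambda>x. (\<Sum>i<n. f i x) + f n x) = (\<lambda>x. R (\<lambda>x. \<Sum>i<n. f i x) x + R (f n) x)"
    by (rule transfer_operator_add[OF R]) measurable
  with Suc show ?case by simp
qed

text \<open>
  The iterates of a transfer operator are again transfer operators. Every fact about a
  single operator therefore applies to all powers without a separate induction.
\<close>

lemma transfer_operator_funpow:
  assumes s[measurable]: "\<sigma> \<in> measurable borel borel" and R: "transfer_operator \<sigma> R"
  shows "transfer_operator (\<sigma> ^^ n) (R ^^ n)"
proof (induction n)
  case 0
  show ?case by (simp add: transfer_operator_def linear_on_measurable_def)
next
  case (Suc n)
  note m = transfer_operator_measurable[OF Suc] transfer_operator_measurable[OF R]
  have [measurable]: "(\<sigma> ^^ k) \<in> measurable borel borel" for k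
    by (rule measurable_compose_n) measurable
  show ?case
    unfolding transfer_operator_def linear_on_measurable_def
  proof (intro conjI ballI allI impI)
    fix f g :: "'a \<Rightarrow> real"
    assume f[measurable]: "f \<in> borel_measurable borel"
      and g[measurable]: "g \<in> borel_measurable borel"
    have [measurable]: "f \<circ> \<sigma> \<in> borel_measurable borel" by measurable
    have "(R ^^ n) (\<lambda>x. (f \<circ> \<sigma>) ((\<sigma> ^^ n) x) * g x) = (\<lambda>x. (f \<circ> \<sigma>) x * (R ^^ n) g x)"
      by (rule transfer_operator_pull_out[OF Suc]) measurable
    then show "(R ^^ Suc n) (\<lambda>x. f ((\<sigma> ^^ Suc n) x) * g x) = (\<lambda>x. f x * (R ^^ Suc n) g x)"
      using transfer_operator_pull_out[OF R, of f "(R ^^ n) g"] m f g by simp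
  qed (use m in \<open>auto simp: transfer_operator_add[OF Suc] transfer_operator_add[OF R]
      transfer_operator_scale[OF Suc] transfer_operator_scale[OF R]
      intro!: transfer_operator_nonneg[OF R] transfer_operator_nonneg[OF Suc]\<close>)
qed

section \<open>Automatic sigma-continuity\<close>

text \<open>
  Sigma-continuity is a consequence of positivity because the operator acts on all
  real-valued measurable functions, the unbounded ones included. If \<open>u n\<close> decreases to 0,
  then for \<open>\<epsilon> > 0\<close> the series \<open>g = \<Sum>n. max 0 (u n - \<epsilon>)\<close> has only finitely many nonzero
  terms at every point, so it is an admissible argument of \<open>R\<close>. Its first \<open>n\<close> terms are all at
  least \<open>max 0 (u n - \<epsilon>)\<close>, so \<open>R\<close> of that function is at most \<open>R g / n\<close>.
\<close>

lemma transfer_operator_tendsto_0: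
  assumes R: "transfer_operator \<sigma> R"
    and u[measurable]: "\<And>n. u n \<in> borel_measurable borel"
    and nonneg: "\<And>n x. 0 \<le> u n x"
    and dec: "\<And>n x. u (Suc n) x \<le> u n x"
    and lim: "\<And>x. (\<lambda>n. u n x) \<longlonglongrightarrow> 0"
  shows "(\<lambda>n. R (u n) x) \<longlonglongrightarrow> 0"
proof (rule LIMSEQ_I)
  fix r :: real assume r: "0 < r"
  define c where "c = R (\<lambda>_. 1) x"
  have c: "0 \<le> c"
    unfolding c_def by (rule transfer_operator_nonneg[OF R]) auto
  \<comment> \<open>the added 1 covers the case \<open>R 1 x = 0\<close>\<close>
  define e where "e = r / (2 * (c + 1))"
  have e: "0 < e" using r c by (simp add: e_def)
  have ec: "e * c < r / 2"
    using r c by (simp add: e_def field_simps)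
  define v where "v = (\<lambda>n x. max 0 (u n x - e))"
  have v[measurable]: "v n \<in> borel_measurable borel" for n
    unfolding v_def by measurable
  have v_nonneg: "0 \<le> v n x" for n x by (simp add: v_def)
  have decu: "decseq (\<lambda>n. u n x)" for x
    using dec by (simp add: decseq_Suc_iff)
  have decv: "v n x \<le> v m x" if "m \<le> n" for m n x
    using decseqD[OF decu that, of x] by (auto simp: v_def)
  have summ: "summable (\<lambda>n. v n x)" for x
  proof -
    obtain N where N: "\<And>n. n \<ge> N \<Longrightarrow> u n x < e"
      using LIMSEQ_D[OF lim[of x] e] nonneg by (auto simp: abs_less_iff)
    have "v n x = 0" if "n \<ge> N" for n
      using N[OF that] by (simp add: v_def)
    then show ?thesis
      by (intro summable_finite[of "{..<N}"]) (auto simp: not_less)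
  qed
  define g where "g = (\<lambda>x. \<Sum>n. v n x)"
  have g[measurable]: "g \<in> borel_measurable borel"
    unfolding g_def by measurable
  have g_nonneg: "0 \<le> g x" for x
    unfolding g_def by (intro suminf_nonneg summ v_nonneg)
  have Rg: "0 \<le> R g x"
    by (rule transfer_operator_nonneg[OF R]) (auto simp: g_nonneg)
  have bound: "real n * R (v n) x \<le> R g x" for n
  proof -
    have "real n * R (v n) x = (\<Sum>i<n. R (v n) x)" by simp
    also have "\<dots> \<le> (\<Sum>i<n. R (v i) x)"
      by (intro sum_mono transfer_operator_mono[OF R]) (auto intro: decv)
    also have "\<dots> = R (\<lambda>x. \<Sum>i<n. v i x) x"
      by (rule transfer_operator_sum[OF R, symmetric]) measurable
    also have "\<dots> \<le> R g x"
      unfolding g_def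
      by (intro transfer_operator_mono[OF R] sum_le_suminf summ)
        (auto intro: v_nonneg simp flip: g_def)
    finally show ?thesis .
  qed
  obtain N :: nat where N: "2 * (R g x + 1) / r < N"
    using reals_Archimedean2 by blast
  have Npos: "0 < N"
    using N Rg r by (metis add_nonneg_pos divide_pos_pos less_trans mult_pos_pos of_nat_0_less_iff zero_less_numeral zero_less_one)
  show "\<exists>N. \<forall>n\<ge>N. norm (R (u n) x - 0) < r"
  proof (intro exI allI impI)
    fix n assume n: "N \<le> n"
    have "R (u n) x \<le> R (\<lambda>x. v n x + e * 1) x"
      by (intro transfer_operator_mono[OF R]) (auto simp: v_def)
    also have "\<dots> = R (v n) x + R (\<lambda>_. e * 1) x"
      by (subst transfer_operator_add[OF R]) auto
    also have "\<dots> = R (v n) x + e * c"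
      unfolding c_def by (subst transfer_operator_scale[OF R]) auto
    finally have 1: "R (u n) x \<le> R (v n) x + e * c" .
    have "2 * (R g x + 1) / r < real n" using N n by linarith
    then have "2 * R g x < real n * r"
      using r by (simp add: field_simps)
    then have "real n * (2 * R (v n) x) < real n * r"
      using bound[of n] by linarith
    then have "R (v n) x < r / 2"
      using n Npos by (simp add: mult_less_cancel_left)
    then have "R (u n) x < r" using 1 ec by linarith
    moreover have "0 \<le> R (u n) x"
      by (rule transfer_operator_nonneg[OF R]) (auto intro: nonneg)
    ultimately show "norm (R (u n) x - 0) < r" by simp
  qed
qed

lemma transfer_operator_tendsto:
  assumes R: "transfer_operator \<sigma> R"
    and u[measurable]: "\<And>n. u n \<in> borel_measurable borel" and v[measurable]: "v \<in> borel_measurable borel"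
    and inc: "\<And>n x. u n x \<le> u (Suc n) x"
    and lim: "\<And>x. (\<lambda>n. u n x) \<longlonglongrightarrow> v x"
  shows "(\<lambda>n. R (u n) x) \<longlonglongrightarrow> R v x"
proof -
  have le: "u n x \<le> v x" for n x
    using inc by (intro incseq_le[OF _ lim]) (auto simp: incseq_Suc_iff)
  have "(\<lambda>n. R (\<lambda>x. v x - u n x) x) \<longlonglongrightarrow> 0"
  proof (rule transfer_operator_tendsto_0[OF R])
    show "(\<lambda>n. v x - u n x) \<longlonglongrightarrow> 0" for x
      using tendsto_diff[OF tendsto_const lim, of "v x" x] by simp
  qed (use le inc in auto)
  then have "(\<lambda>n. R v x - (R v x - R (u n) x)) \<longlonglongrightarrow> R v x - 0"
    by (intro tendsto_diff tendsto_const) (simp add: transfer_operator_diff[OF R])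
  then show ?thesis by simp
qed

text \<open>
  The value \<open>R u x\<close> depends only on \<open>u\<close> on the fibre of \<open>\<sigma>\<close> over \<open>x\<close>: pulling out the
  indicator of the closed set \<open>{x}\<close> shows that \<open>u\<close> may be cut off outside that fibre.
  With sigma-continuity, failure of convergence at \<open>x\<close> is thus inherited from a point above
  \<open>x\<close>; this is what lets a path be prolonged by one step.
\<close>

lemma transfer_operator_fibre_witness:
  fixes \<sigma> :: "'a::t1_space \<Rightarrow> 'a"
  assumes s[measurable]: "\<sigma> \<in> measurable borel borel" and R: "transfer_operator \<sigma> R"
    and u[measurable]: "\<And>n. u n \<in> borel_measurable borel"
    and nonneg: "\<And>n x. 0 \<le> u n x"
    and dec: "\<And>n x. u (Suc n) x \<le> u n x"
    and nlim: "\<not> (\<lambda>n. R (u n) x) \<longlonglongrightarrow> 0"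
  shows "\<exists>y. \<sigma> y = x \<and> \<not> (\<lambda>n. u n y) \<longlonglongrightarrow> 0"
proof (rule ccontr)
  assume "\<not> ?thesis"
  then have lim: "(\<lambda>n. u n y) \<longlonglongrightarrow> 0" if "\<sigma> y = x" for y
    using that by blast
  let ?v = "\<lambda>n y. indicator {x} (\<sigma> y) * u n y"
  have [measurable]: "{x} \<in> sets borel" by simp
  have "(\<lambda>n. R (?v n) x) \<longlonglongrightarrow> 0"
  proof (rule transfer_operator_tendsto_0[OF R])
    show "(\<lambda>n. ?v n y) \<longlonglongrightarrow> 0" for y
      using lim by (cases "\<sigma> y = x") auto
  qed (auto simp: nonneg dec split: split_indicator)
  moreover have "R (?v n) = (\<lambda>y. indicator {x} y * R (u n) y)" for n
    by (rule transfer_operator_pull_out[OF R]) measurable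
  ultimately show False using nlim by simp
qed

section \<open>Cylinder sets of the solenoid\<close>

abbreviation cylinder :: "('a \<Rightarrow> 'a) \<Rightarrow> nat \<Rightarrow> 'a set \<Rightarrow> (nat \<Rightarrow> 'a) set" where
  "cylinder \<sigma> n B \<equiv> (\<lambda>\<omega>. \<omega> n) -` B \<inter> solenoid \<sigma>"

abbreviation borel_cylinders :: "('a::topological_space \<Rightarrow> 'a) \<Rightarrow> (nat \<Rightarrow> 'a) set set" where
  "borel_cylinders \<sigma> \<equiv> {cylinder \<sigma> n B | n B. B \<in> sets borel}"

lemma solenoid_funpow:
  assumes "\<omega> \<in> solenoid \<sigma>"
  shows "(\<sigma> ^^ m) (\<omega> (n + m)) = \<omega> n"
  using assms by (induction m) (auto simp: solenoid_def funpow_swap1)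

lemma solenoid_coordinate_surj:
  assumes "surj \<sigma>"
  shows "\<exists>\<omega>\<in>solenoid \<sigma>. \<omega> n = x"
proof -
  define \<omega> where "\<omega> k = (if k \<le> n then (\<sigma> ^^ (n - k)) x else (inv \<sigma> ^^ (k - n)) x)" for k
  have "\<sigma> (\<omega> (Suc k)) = \<omega> k" for k
  proof (cases "k < n")
    case True
    then have "n - k = Suc (n - Suc k)" by simp
    with True show ?thesis by (simp add: \<omega>_def)
  next
    case False
    then have "\<sigma> (\<omega> (Suc k)) = (inv \<sigma> ^^ (k - n)) x"
      by (simp add: \<omega>_def Suc_diff_le surj_f_inv_f[OF assms])
    with False show ?thesis by (auto simp: \<omega>_def)
  qed
  then have "\<omega> \<in> solenoid \<sigma>" by (simp add: solenoid_def)
  moreover have "\<omega> n = x" by (simp add: \<omega>_def)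
  ultimately show ?thesis by blast
qed

lemma coordinate_image_cylinder:
  assumes "surj \<sigma>"
  shows "(\<lambda>\<omega>. \<omega> n) ` cylinder \<sigma> n B = B"
proof
  show "B \<subseteq> (\<lambda>\<omega>. \<omega> n) ` cylinder \<sigma> n B"
  proof
    fix x assume "x \<in> B"
    moreover obtain \<omega> where "\<omega> \<in> solenoid \<sigma>" "\<omega> n = x"
      using solenoid_coordinate_surj[OF assms] by blast
    ultimately show "x \<in> (\<lambda>\<omega>. \<omega> n) ` cylinder \<sigma> n B"
      by (intro image_eqI[of _ _ \<omega>]) auto
  qed
qed auto

text \<open>
  A path determines its earlier coordinates from any later one. Hence the cylinders over
  single coordinates, taken with growing index, already exhaust all finite-dimensional
  cylinders, and finitely many of them can be written over one common coordinate.
\<close>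

lemma cylinder_lift:
  fixes \<sigma> :: "'a \<Rightarrow> 'a"
  shows "cylinder \<sigma> n B = cylinder \<sigma> (n + m) ((\<sigma> ^^ m) -` B)"
  by (auto simp: solenoid_funpow)

lemma funpow_vimage_borel:
  fixes \<sigma> :: "'a::topological_space \<Rightarrow> 'a"
  assumes [measurable]: "\<sigma> \<in> measurable borel borel" "B \<in> sets borel"
  shows "(\<sigma> ^^ m) -` B \<in> sets borel"
proof -
  have "(\<sigma> ^^ m) \<in> measurable borel borel"
    by (rule measurable_compose_n) measurable
  from measurable_sets[OF this assms(2)] show ?thesis by simp
qed

lemma cylinder_common_level:
  assumes s: "\<sigma> \<in> measurable borel borel" and "C \<in> borel_cylinders \<sigma>" "D \<in> borel_cylinders \<sigma>"
  obtains n A B where "A \<in> sets borel" "B \<in> sets borel" "C = cylinder \<sigma> n A" "D = cylinder \<sigma> n B"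
proof -
  obtain k A l B where *: "C = cylinder \<sigma> k A" "A \<in> sets borel" "D = cylinder \<sigma> l B" "B \<in> sets borel"
    using assms(2,3) by blast
  show thesis
  proof (rule that)
    show "C = cylinder \<sigma> (k + l) ((\<sigma> ^^ l) -` A)"
      unfolding * by (rule cylinder_lift)
    show "D = cylinder \<sigma> (k + l) ((\<sigma> ^^ k) -` B)"
      unfolding * by (subst add.commute) (rule cylinder_lift)
  qed (use * funpow_vimage_borel[OF s] in auto)
qed

lemma algebra_borel_cylinders:
  assumes s: "\<sigma> \<in> measurable borel borel"
  shows "algebra (solenoid \<sigma>) (borel_cylinders \<sigma>)"
  unfolding algebra_iff_Int
proof (intro conjI ballI)
  show "{} \<in> borel_cylinders \<sigma>"
    by (auto intro!: exI[of _ "{}"])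
  fix C assume "C \<in> borel_cylinders \<sigma>"
  then obtain n B where "C = cylinder \<sigma> n B" "B \<in> sets borel" by blast
  then show "solenoid \<sigma> - C \<in> borel_cylinders \<sigma>"
    by (auto intro!: exI[of _ n] exI[of _ "- B"])
next
  fix C D assume "C \<in> borel_cylinders \<sigma>" "D \<in> borel_cylinders \<sigma>"
  then obtain n A B where "A \<in> sets borel" "B \<in> sets borel" "C = cylinder \<sigma> n A" "D = cylinder \<sigma> n B"
    by (rule cylinder_common_level[OF s])
  then show "C \<inter> D \<in> borel_cylinders \<sigma>"
    by (auto intro!: exI[of _ n] exI[of _ "A \<inter> B"])
qed auto

lemma space_solenoid_space: "space (solenoid_space \<sigma>) = solenoid \<sigma>"
  unfolding solenoid_space_def by (rule space_measure_of) auto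

lemma sets_solenoid_space: "sets (solenoid_space \<sigma>) = sigma_sets (solenoid \<sigma>) (borel_cylinders \<sigma>)"
  unfolding solenoid_space_def by (rule sets_measure_of) auto

lemma cylinder_measurable:
  assumes "sets P = sets (solenoid_space \<sigma>)" "B \<in> sets borel"
  shows "cylinder \<sigma> n B \<in> sets P"
  unfolding assms(1) sets_solenoid_space using assms(2) by (intro sigma_sets.Basic CollectI) blast

lemma coordinate_measurable:
  assumes "sets P = sets (solenoid_space \<sigma>)"
  shows "(\<lambda>\<omega>. \<omega> n) \<in> measurable P borel"
proof (rule measurableI)
  fix A :: "'a set" assume "A \<in> sets borel"
  moreover have "space P = solenoid \<sigma>"
    using sets_eq_imp_space_eq[OF assms] by (simp add: space_solenoid_space)
  ultimately show "(\<lambda>\<omega>. \<omega> n) -` A \<inter> space P \<in> sets P"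
    using cylinder_measurable[OF assms] by simp
qed simp

section \<open>The path measure of a harmonic function\<close>

locale harmonic_transfer =
  fixes \<sigma> :: "'a::t1_space \<Rightarrow> 'a" and R :: "('a \<Rightarrow> real) \<Rightarrow> ('a \<Rightarrow> real)"
    and h :: "'a \<Rightarrow> real" and \<mu> :: "'a measure"
  assumes sigma_measurable[measurable]: "\<sigma> \<in> measurable borel borel"
    and sigma_surj: "surj \<sigma>"
    and transfer: "transfer_operator \<sigma> R"
    and sets_base[measurable_cong]: "sets \<mu> = sets borel"
    and h_measurable[measurable]: "h \<in> borel_measurable borel"
    and h_nonneg: "0 \<le> h x"
    and h_harmonic: "R h = h"
    and h_normalized: "(\<integral>\<^sup>+x. ennreal (h x) \<partial>\<mu>) = 1"
begin

text \<open>
  In terms of the path measure to be constructed, \<open>push n g x\<close> is, for almost every \<open>x\<close>,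
  \<open>h x\<close> times the conditional expectation of \<open>g (\<omega> n)\<close> given \<open>\<omega> 0 = x\<close>, and \<open>mass n\<close> is the
  law of \<open>\<omega> n\<close>.
\<close>

definition push :: "nat \<Rightarrow> ('a \<Rightarrow> real) \<Rightarrow> 'a \<Rightarrow> real" where
  "push n g = (R ^^ n) (\<lambda>y. g y * h y)"

definition mass :: "nat \<Rightarrow> 'a set \<Rightarrow> ennreal" where
  "mass n B = (\<integral>\<^sup>+x. ennreal (push n (indicator B) x) \<partial>\<mu>)"

lemma funpow_sigma_measurable[measurable]: "(\<sigma> ^^ n) \<in> measurable borel borel"
  by (rule measurable_compose_n) measurable

lemmas transfer_funpow = transfer_operator_funpow[OF sigma_measurable transfer]

lemma push_measurable[measurable]:
  assumes [measurable]: "g \<in> borel_measurable borel"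
  shows "push n g \<in> borel_measurable borel"
  unfolding push_def by (rule transfer_operator_measurable[OF transfer_funpow]) measurable

lemma push_measurable_base:
  assumes [measurable]: "g \<in> borel_measurable borel"
  shows "(\<lambda>x. ennreal (push n g x)) \<in> borel_measurable \<mu>"
  by measurable

lemma push_nonneg:
  assumes [measurable]: "g \<in> borel_measurable borel" and "\<And>x. 0 \<le> g x"
  shows "0 \<le> push n g x"
  unfolding push_def
  by (rule transfer_operator_nonneg[OF transfer_funpow]) (auto simp: assms(2) h_nonneg)

lemma push_mono:
  assumes [measurable]: "f \<in> borel_measurable borel" "g \<in> borel_measurable borel" and "\<And>x. f x \<le> g x"
  shows "push n f x \<le> push n g x"
  unfolding push_def
  by (rule transfer_operator_mono[OF transfer_funpow]) (auto simp: assms(3) h_nonneg intro: mult_right_mono)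

lemma push_add:
  assumes [measurable]: "f \<in> borel_measurable borel" "g \<in> borel_measurable borel"
  shows "push n (\<lambda>x. f x + g x) = (\<lambda>x. push n f x + push n g x)"
  unfolding push_def distrib_right
  by (rule transfer_operator_add[OF transfer_funpow]) measurable

lemma push_scale:
  assumes [measurable]: "f \<in> borel_measurable borel"
  shows "push n (\<lambda>x. c * f x) = (\<lambda>x. c * push n f x)"
  unfolding push_def mult.assoc
  by (rule transfer_operator_scale[OF transfer_funpow]) measurable

lemma push_one: "push n (\<lambda>_. 1) = h"
  by (induction n) (simp_all add: push_def h_harmonic)

lemma push_Suc: "push (Suc n) g = R (push n g)"
  by (simp add: push_def)

text \<open>Here harmonicity enters: it makes the laws of the coordinates consistent.\<close>

lemma push_lift:
  assumes [measurable]: "g \<in> borel_measurable borel"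
  shows "push (n + m) (\<lambda>y. g ((\<sigma> ^^ m) y)) = push n g"
proof -
  have "(R ^^ m) (\<lambda>y. g ((\<sigma> ^^ m) y) * h y) = (\<lambda>y. g y * (R ^^ m) h y)"
    by (rule transfer_operator_pull_out[OF transfer_funpow]) measurable
  moreover have "(R ^^ m) h = h"
    by (induction m) (simp_all add: h_harmonic)
  ultimately show ?thesis
    by (simp add: push_def funpow_add)
qed

lemma push_tendsto:
  assumes [measurable]: "\<And>i. U i \<in> borel_measurable borel" "u \<in> borel_measurable borel"
    and "\<And>i x. U i x \<le> U (Suc i) x" and "\<And>x. (\<lambda>i. U i x) \<longlonglongrightarrow> u x"
  shows "(\<lambda>i. push n (U i) x) \<longlonglongrightarrow> push n u x"
  unfolding push_def
  by (rule transfer_operator_tendsto[OF transfer_funpow])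
    (auto simp: h_nonneg intro: mult_right_mono assms tendsto_intros)

lemma mass_lift:
  assumes [measurable]: "B \<in> sets borel"
  shows "mass (n + m) ((\<sigma> ^^ m) -` B) = mass n B"
proof -
  have "indicator ((\<sigma> ^^ m) -` B) = (\<lambda>y. indicator B ((\<sigma> ^^ m) y) :: real)"
    by (auto simp: indicator_def)
  then show ?thesis
    unfolding mass_def using push_lift[of "indicator B" n m] by simp
qed

lemma mass_mono:
  assumes [measurable]: "A \<in> sets borel" "B \<in> sets borel" and "A \<subseteq> B"
  shows "mass n A \<le> mass n B"
  unfolding mass_def
  by (intro nn_integral_mono ennreal_leI push_mono)
    (use \<open>A \<subseteq> B\<close> in \<open>auto split: split_indicator\<close>)

lemma mass_empty: "mass n {} = 0"
proof -
  have "indicator {} = (\<lambda>x::'a. 0 * 1 :: real)" by (simp add: fun_eq_iff)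
  then have "push n (indicator {}) = (\<lambda>_. 0)"
    using push_scale[of "\<lambda>_. 1" n 0] by simp
  then show ?thesis by (simp add: mass_def)
qed

lemma mass_UNIV: "mass n UNIV = 1"
  by (simp add: mass_def push_one h_normalized)

lemma mass_Un:
  assumes [measurable]: "A \<in> sets borel" "B \<in> sets borel" and "A \<inter> B = {}"
  shows "mass n (A \<union> B) = mass n A + mass n B"
proof -
  have "indicator (A \<union> B) = (\<lambda>x. indicator A x + indicator B x :: real)"
    using assms(3) by (intro ext) (auto split: split_indicator)
  then show ?thesis
    unfolding mass_def
    by (simp add: push_add push_nonneg ennreal_plus nn_integral_add)
qed

text \<open>
  The sets \<open>D n\<close> are the bases of a decreasing sequence of cylinders with empty intersection. If their masses do not
  tend to 0, then dominated convergence gives a starting point \<open>x 0\<close> at which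
  \<open>push n (indicator (D n))\<close> does not tend to 0, and the fibre argument prolongs it step by step
  to a path along which the corresponding tails stay away from 0. Such a path lies in all
  the cylinders, which is a contradiction. Since each new point is chosen in the fibre over the previous one, it is a
  path of the solenoid itself and not merely of the product space.
\<close>

lemma mass_tendsto_0:
  assumes D[measurable]: "\<And>n. D n \<in> sets borel"
    and dec: "\<And>n. D (Suc n) \<subseteq> \<sigma> -` D n"
    and empty: "\<And>\<omega>. \<omega> \<in> solenoid \<sigma> \<Longrightarrow> \<exists>n. \<omega> n \<notin> D n"
  shows "(\<lambda>n. mass n (D n)) \<longlonglongrightarrow> 0"
proof (rule ccontr)
  assume nlim: "\<not> ?thesis"
  \<comment> \<open>conditionally on \<open>\<omega> k\<close>, the weight of the cylinder over coordinate \<open>k + n\<close>\<close>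
  define \<phi> where "\<phi> k n = push n (indicator (D (k + n)))" for k n
  have \<phi>[measurable]: "\<phi> k n \<in> borel_measurable borel" for k n
    unfolding \<phi>_def by measurable
  have \<phi>_nonneg: "0 \<le> \<phi> k n x" for k n x
    unfolding \<phi>_def by (rule push_nonneg) auto
  have \<phi>_dec: "\<phi> k (Suc n) x \<le> \<phi> k n x" for k n x
  proof -
    have "\<phi> k (Suc n) x \<le> push (n + 1) (\<lambda>y. indicator (D (k + n)) ((\<sigma> ^^ 1) y)) x"
      unfolding \<phi>_def using dec[of "k + n"]
      by (auto intro!: push_mono split: split_indicator)
    also have "\<dots> = \<phi> k n x"
      unfolding \<phi>_def by (subst push_lift) auto
    finally show ?thesis .
  qed
  have \<phi>_Suc: "\<phi> k (Suc n) = R (\<phi> (Suc k) n)" for k n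
    by (simp add: \<phi>_def push_Suc)
  have start: "\<exists>x. \<not> (\<lambda>n. \<phi> 0 n x) \<longlonglongrightarrow> 0"
  proof (rule ccontr)
    assume "\<not> ?thesis"
    then have lim: "(\<lambda>n. \<phi> 0 n x) \<longlonglongrightarrow> 0" for x by blast
    have "\<phi> 0 n x \<le> h x" for n x
      using push_mono[of "indicator (D n)" "\<lambda>_. 1" n x] by (simp add: \<phi>_def push_one)
    then have "(\<lambda>n. \<integral>\<^sup>+x. ennreal (\<phi> 0 n x) \<partial>\<mu>) \<longlonglongrightarrow> (\<integral>\<^sup>+x. ennreal 0 \<partial>\<mu>)"
      by (intro nn_integral_dominated_convergence[where w="\<lambda>x. ennreal (h x)"])
        (auto simp: h_normalized intro!: ennreal_leI tendsto_ennrealI lim simp del: ennreal_0)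
    with nlim show False
      by (simp add: mass_def \<phi>_def)
  qed
  have step: "\<exists>y. \<not> (\<lambda>n. \<phi> (Suc k) n y) \<longlonglongrightarrow> 0 \<and> \<sigma> y = x"
    if "\<not> (\<lambda>n. \<phi> k n x) \<longlonglongrightarrow> 0" for k x
  proof -
    have "\<not> (\<lambda>n. R (\<phi> (Suc k) n) x) \<longlonglongrightarrow> 0"
      using that filterlim_sequentially_Suc[of "\<lambda>n. \<phi> k n x" "nhds 0"] by (simp add: \<phi>_Suc)
    then have "\<exists>y. \<sigma> y = x \<and> \<not> (\<lambda>n. \<phi> (Suc k) n y) \<longlonglongrightarrow> 0"
      by (intro transfer_operator_fibre_witness[OF sigma_measurable transfer, where u="\<phi> (Suc k)"]
          \<phi> \<phi>_nonneg \<phi>_dec)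
    then show ?thesis by blast
  qed
  have "\<exists>\<omega>. \<forall>k. \<not> (\<lambda>n. \<phi> k n (\<omega> k)) \<longlonglongrightarrow> 0 \<and> \<sigma> (\<omega> (Suc k)) = \<omega> k"
    by (rule dependent_nat_choice[of "\<lambda>k x. \<not> (\<lambda>n. \<phi> k n x) \<longlonglongrightarrow> 0" "\<lambda>k x y. \<sigma> y = x"])
      (fact start, fact step)
  then obtain \<omega> where \<omega>: "\<And>k. \<not> (\<lambda>n. \<phi> k n (\<omega> k)) \<longlonglongrightarrow> 0" "\<And>k. \<sigma> (\<omega> (Suc k)) = \<omega> k"
    by metis
  have "\<omega> k \<in> D k" for k
  proof (rule ccontr)
    assume "\<omega> k \<notin> D k"
    then have "\<phi> k 0 (\<omega> k) = 0" by (simp add: \<phi>_def push_def)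
    moreover have "\<phi> k n (\<omega> k) \<le> \<phi> k 0 (\<omega> k)" for n
      by (rule lift_Suc_antimono_le[of "\<lambda>n. \<phi> k n (\<omega> k)"]) (auto intro: \<phi>_dec)
    ultimately have "(\<lambda>n. \<phi> k n (\<omega> k)) = (\<lambda>_. 0)"
      using \<phi>_nonneg by (intro ext antisym) auto
    with \<omega>(1)[of k] show False by simp
  qed
  moreover have "\<omega> \<in> solenoid \<sigma>" using \<omega>(2) by (simp add: solenoid_def)
  ultimately show False using empty by blast
qed

text \<open>
  A cylinder can be written over each sufficiently large coordinate \<open>m\<close>.
  Because the coordinate maps are onto, the base over coordinate \<open>m\<close> is recovered from the
  cylinder as its image; its mass is the same for all large \<open>m\<close>. Taking
  the limit over \<open>m\<close> avoids the choice of a representation.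
\<close>

definition cylinder_mass :: "(nat \<Rightarrow> 'a) set \<Rightarrow> ennreal" where
  "cylinder_mass C = lim (\<lambda>m. mass m ((\<lambda>\<omega>. \<omega> m) ` C))"

lemma cylinder_mass_eq:
  assumes "B \<in> sets borel"
  shows "cylinder_mass (cylinder \<sigma> n B) = mass n B"
proof -
  have "mass m ((\<lambda>\<omega>. \<omega> m) ` cylinder \<sigma> n B) = mass n B" if "n \<le> m" for m
  proof -
    obtain k where m: "m = n + k" using le_Suc_ex[OF \<open>n \<le> m\<close>] by blast
    have "cylinder \<sigma> n B = cylinder \<sigma> m ((\<sigma> ^^ k) -` B)"
      unfolding m by (rule cylinder_lift)
    then have "(\<lambda>\<omega>. \<omega> m) ` cylinder \<sigma> n B = (\<sigma> ^^ k) -` B"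
      by (simp only: coordinate_image_cylinder[OF sigma_surj])
    then show ?thesis using mass_lift[OF assms] m by simp
  qed
  then have "(\<lambda>m. mass m ((\<lambda>\<omega>. \<omega> m) ` cylinder \<sigma> n B)) \<longlonglongrightarrow> mass n B"
    by (intro tendsto_eventually eventually_sequentiallyI[of n])
  then show ?thesis
    unfolding cylinder_mass_def by (rule limI)
qed

lemma cylinder_mass_mono:
  assumes "C \<in> borel_cylinders \<sigma>" "D \<in> borel_cylinders \<sigma>" "C \<subseteq> D"
  shows "cylinder_mass C \<le> cylinder_mass D"
proof -
  obtain n A B where *: "A \<in> sets borel" "B \<in> sets borel" "C = cylinder \<sigma> n A" "D = cylinder \<sigma> n B"
    using assms(1,2) by (rule cylinder_common_level[OF sigma_measurable])
  have "A \<subseteq> B"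
    using image_mono[OF \<open>C \<subseteq> D\<close>, of "\<lambda>\<omega>. \<omega> n"]
    by (simp only: * coordinate_image_cylinder[OF sigma_surj])
  with * show ?thesis by (simp add: cylinder_mass_eq mass_mono)
qed

lemma cylinder_mass_additive: "additive (borel_cylinders \<sigma>) cylinder_mass"
  unfolding additive_def
proof (intro ballI impI)
  fix C D assume CD: "C \<in> borel_cylinders \<sigma>" "D \<in> borel_cylinders \<sigma>" and disj: "C \<inter> D = {}"
  obtain n A B where *: "A \<in> sets borel" "B \<in> sets borel" "C = cylinder \<sigma> n A" "D = cylinder \<sigma> n B"
    using CD by (rule cylinder_common_level[OF sigma_measurable])
  have "A \<inter> B = {}"
    using disj solenoid_coordinate_surj[OF sigma_surj, of n] unfolding * by blast
  then have "mass n (A \<union> B) = mass n A + mass n B"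
    using * by (intro mass_Un)
  moreover have "C \<union> D = cylinder \<sigma> n (A \<union> B)"
    unfolding * by auto
  ultimately show "cylinder_mass (C \<union> D) = cylinder_mass C + cylinder_mass D"
    using * cylinder_mass_eq[of A n] cylinder_mass_eq[of B n] cylinder_mass_eq[of "A \<union> B" n]
    by (metis sets.Un)
qed

text \<open>
  The cylinders \<open>C i\<close> may be based at arbitrary coordinates. Among those with index up to \<open>n\<close>, the ones
  based at a coordinate up to \<open>n\<close> intersect in a cylinder over \<open>n\<close> that contains \<open>C n\<close>; these
  intersections decrease to the empty set as well, and the preceding convergence applies to them.
\<close>

lemma cylinder_mass_empty_continuous:
  assumes C: "range C \<subseteq> borel_cylinders \<sigma>" and dec: "decseq C" and empty: "(\<Inter>i. C i) = {}"
  shows "(\<lambda>i. cylinder_mass (C i)) \<longlonglongrightarrow> 0"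
proof -
  have "\<forall>i. \<exists>l B. B \<in> sets borel \<and> C i = cylinder \<sigma> l B"
    using C by blast
  then obtain l B where B: "\<And>i. B i \<in> sets borel" and Ci: "\<And>i. C i = cylinder \<sigma> (l i) (B i)"
    by metis
  define D where "D n = (\<Inter>i\<in>{i\<in>{..n}. l i \<le> n}. (\<sigma> ^^ (n - l i)) -` B i)" for n
  have D: "D n \<in> sets borel" for n
  proof (cases "{i\<in>{..n}. l i \<le> n} = {}")
    case False
    then show ?thesis
      unfolding D_def by (intro sets.finite_INT funpow_vimage_borel B sigma_measurable) auto
  next
    case True
    then show ?thesis unfolding D_def by (metis INT_empty sets.top space_borel)
  qed
  have cyl: "\<omega> n \<in> D n \<longleftrightarrow> (\<forall>i\<le>n. l i \<le> n \<longrightarrow> \<omega> \<in> C i)" if "\<omega> \<in> solenoid \<sigma>" for \<omega> n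
  proof -
    have "(\<sigma> ^^ (n - l i)) (\<omega> n) = \<omega> (l i)" if "l i \<le> n" for i
      using solenoid_funpow[OF \<open>\<omega> \<in> solenoid \<sigma>\<close>, of "n - l i" "l i"] that by simp
    then show ?thesis
      using that by (auto simp: D_def Ci)
  qed
  have "(\<lambda>n. mass n (D n)) \<longlonglongrightarrow> 0"
  proof (rule mass_tendsto_0[OF D])
    fix n show "D (Suc n) \<subseteq> \<sigma> -` D n"
    proof
      fix x assume "x \<in> D (Suc n)"
      moreover obtain \<omega> where "\<omega> \<in> solenoid \<sigma>" "\<omega> (Suc n) = x"
        using solenoid_coordinate_surj[OF sigma_surj] by blast
      ultimately show "x \<in> \<sigma> -` D n"
        using cyl[of \<omega> n] cyl[of \<omega> "Suc n"] by (auto simp: solenoid_def)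
    qed
  next
    fix \<omega> assume \<omega>: "\<omega> \<in> solenoid \<sigma>"
    obtain i where "\<omega> \<notin> C i" using empty by blast
    then have "\<omega> (max i (l i)) \<notin> D (max i (l i))"
      using cyl[OF \<omega>, of "max i (l i)"] by auto
    then show "\<exists>n. \<omega> n \<notin> D n" by blast
  qed
  then show ?thesis
  proof (rule tendsto_sandwich[OF _ _ tendsto_const, rotated 2])
    have "cylinder_mass (C n) \<le> mass n (D n)" for n
    proof -
      have "C n \<subseteq> cylinder \<sigma> n (D n)"
      proof
        fix \<omega> assume \<omega>: "\<omega> \<in> C n"
        then have "\<omega> \<in> solenoid \<sigma>" by (simp add: Ci)
        moreover have "\<omega> \<in> C i" if "i \<le> n" for i
          using decseqD[OF dec that] \<omega> by blast
        ultimately show "\<omega> \<in> cylinder \<sigma> n (D n)"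
          using cyl by simp
      qed
      moreover have "C n \<in> borel_cylinders \<sigma>" "cylinder \<sigma> n (D n) \<in> borel_cylinders \<sigma>"
        using C D by blast+
      ultimately have "cylinder_mass (C n) \<le> cylinder_mass (cylinder \<sigma> n (D n))"
        by (intro cylinder_mass_mono)
      then show ?thesis by (simp only: cylinder_mass_eq[OF D])
    qed
    then show "\<forall>\<^sub>F n in sequentially. cylinder_mass (C n) \<le> mass n (D n)"
      by simp
  qed simp
qed

lemma path_measure_exists:
  "\<exists>P. sets P = sets (solenoid_space \<sigma>) \<and>
       (\<forall>n. \<forall>B\<in>sets borel. emeasure P (cylinder \<sigma> n B) = mass n B)"
proof -
  have alg: "algebra (solenoid \<sigma>) (borel_cylinders \<sigma>)"
    by (rule algebra_borel_cylinders[OF sigma_measurable])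
  have "cylinder \<sigma> 0 {} = {}" by simp
  then have "positive (borel_cylinders \<sigma>) cylinder_mass"
    using cylinder_mass_eq[of "{}" 0] by (simp only: positive_def mass_empty) simp
  moreover have "cylinder_mass C \<noteq> \<infinity>" if "C \<in> borel_cylinders \<sigma>" for C
  proof -
    from that have "\<exists>n B. C = cylinder \<sigma> n B \<and> B \<in> sets borel" by (rule CollectD)
    then obtain n B where C: "C = cylinder \<sigma> n B" "B \<in> sets borel" by blast
    have "cylinder_mass C = mass n B"
      unfolding C(1) by (rule cylinder_mass_eq[OF C(2)])
    also have "\<dots> \<le> 1"
      using mass_mono[of B UNIV n] C(2) by (simp add: mass_UNIV)
    finally show ?thesis by (auto simp: top_unique)
  qed
  ultimately have "\<exists>P. (\<forall>C\<in>borel_cylinders \<sigma>. P C = cylinder_mass C) \<and>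
      measure_space (solenoid \<sigma>) (sigma_sets (solenoid \<sigma>) (borel_cylinders \<sigma>)) P"
    using algebra.axioms(1)[OF alg] cylinder_mass_additive cylinder_mass_empty_continuous
    by (intro ring_of_sets.caratheodory_empty_continuous)
  then obtain P where P: "\<forall>C\<in>borel_cylinders \<sigma>. P C = cylinder_mass C"
    and ms: "measure_space (solenoid \<sigma>) (sigma_sets (solenoid \<sigma>) (borel_cylinders \<sigma>)) P"
    by (elim exE conjE)
  let ?P = "measure_of (solenoid \<sigma>) (borel_cylinders \<sigma>) P"
  have sub: "borel_cylinders \<sigma> \<subseteq> Pow (solenoid \<sigma>)" by auto
  show ?thesis
  proof (intro exI conjI allI ballI)
    show "sets ?P = sets (solenoid_space \<sigma>)"
      by (simp add: sets_measure_of[OF sub] sets_solenoid_space)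
    fix n and B :: "'a set" assume B: "B \<in> sets borel"
    have "emeasure ?P (cylinder \<sigma> n B) = P (cylinder \<sigma> n B)"
    proof (rule emeasure_measure_of[OF refl sub])
      show "cylinder \<sigma> n B \<in> sets ?P"
        using B by (auto simp: sets_measure_of[OF sub])
    qed (use ms in \<open>simp_all add: measure_space_def sets_measure_of[OF sub]\<close>)
    also have "\<dots> = mass n B"
      using bspec[OF P, of "cylinder \<sigma> n B"] B cylinder_mass_eq[OF B] by auto
    finally show "emeasure ?P (cylinder \<sigma> n B) = mass n B" .
  qed
qed

section \<open>Integrals along paths\<close>

lemma push_pull_out:
  assumes [measurable]: "f \<in> borel_measurable borel" "g \<in> borel_measurable borel"
  shows "push n (\<lambda>y. f ((\<sigma> ^^ n) y) * g y) = (\<lambda>x. f x * push n g x)"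
  unfolding push_def mult.assoc
  by (rule transfer_operator_pull_out[OF transfer_funpow]) measurable

text \<open>
  All factors are moved to the last coordinate: on a path, \<open>f k (\<omega> k)\<close> equals
  \<open>f k ((\<sigma> ^^ (n - k)) (\<omega> n))\<close>. The pull-out property undoes exactly this,
  factor by factor, and produces the nested expression.
\<close>

lemma nested_transfer_eq_push:
  assumes "\<And>k. k \<le> n \<Longrightarrow> f k \<in> borel_measurable borel"
  shows "f 0 x * nested_transfer R h (map f [1..<Suc n]) x
       = push n (\<lambda>y. \<Prod>k\<le>n. f k ((\<sigma> ^^ (n - k)) y)) x"
  using assms
proof (induction n arbitrary: f x)
  case 0
  show ?case by (simp add: push_def)
next
  case (Suc n)
  let ?F = "\<lambda>y. \<Prod>k\<le>n. f (Suc k) ((\<sigma> ^^ (n - k)) y)"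
  have f0: "f 0 \<in> borel_measurable borel" using Suc.prems by simp
  have fS: "f (Suc k) \<in> borel_measurable borel" if "k \<le> n" for k
    using Suc.prems that by simp
  have F: "?F \<in> borel_measurable borel"
    by (intro borel_measurable_prod measurable_compose[OF funpow_sigma_measurable fS]) simp
  have "map f [1..<Suc (Suc n)] = f (Suc 0) # map (\<lambda>k. f (Suc k)) [1..<Suc n]"
    by (simp add: upt_conv_Cons map_Suc_upt[symmetric] del: upt_Suc)
  then have "nested_transfer R h (map f [1..<Suc (Suc n)])
      = R (\<lambda>x. f (Suc 0) x * nested_transfer R h (map (\<lambda>k. f (Suc k)) [1..<Suc n]) x)"
    by (simp del: upt_Suc)
  also have "\<dots> = R (push n ?F)"
    using Suc.IH[of "\<lambda>k. f (Suc k)"] fS by (simp del: upt_Suc)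
  finally have "f 0 x * nested_transfer R h (map f [1..<Suc (Suc n)]) x = f 0 x * push (Suc n) ?F x"
    by (simp add: push_Suc del: upt_Suc)
  also have "\<dots> = push (Suc n) (\<lambda>y. f 0 ((\<sigma> ^^ Suc n) y) * ?F y) x"
    by (simp only: push_pull_out[OF f0 F])
  also have "(\<lambda>y. f 0 ((\<sigma> ^^ Suc n) y) * ?F y) = (\<lambda>y. \<Prod>k\<le>Suc n. f k ((\<sigma> ^^ (Suc n - k)) y))"
    by (simp only: prod.atMost_Suc_shift diff_Suc_Suc minus_nat.diff_0)
  finally show ?case .
qed

text \<open>
  For indicators this is the hypothesis on the law of the coordinate; it passes to limits of increasing
  sequences because \<open>push n\<close> inherits sigma-continuity from \<open>R\<close>.
\<close>

lemma nn_integral_coordinate: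
  assumes P: "sets P = sets (solenoid_space \<sigma>)"
    and law: "\<And>B. B \<in> sets borel \<Longrightarrow> emeasure P (cylinder \<sigma> n B) = mass n B"
    and F: "F \<in> borel_measurable borel" "\<And>x. 0 \<le> F x"
  shows "(\<integral>\<^sup>+\<omega>. ennreal (F (\<omega> n)) \<partial>P) = (\<integral>\<^sup>+x. ennreal (push n F x) \<partial>\<mu>)"
proof -
  have coord: "(\<lambda>\<omega>. ennreal (G (\<omega> n))) \<in> borel_measurable P"
    if [measurable]: "G \<in> borel_measurable borel" for G
    by (rule measurable_compose[OF coordinate_measurable[OF P]]) measurable
  have space: "space P = solenoid \<sigma>"
    using sets_eq_imp_space_eq[OF P] by (simp add: space_solenoid_space)
  show ?thesis
    using F
  proof (induction F rule: borel_measurable_induct_real)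
    case (set A)
    then have "(\<integral>\<^sup>+\<omega>. ennreal (indicator A (\<omega> n)) \<partial>P) = (\<integral>\<^sup>+\<omega>. indicator (cylinder \<sigma> n A) \<omega> \<partial>P)"
      by (intro nn_integral_cong) (auto simp: space split: split_indicator)
    also have "\<dots> = emeasure P (cylinder \<sigma> n A)"
      using set by (intro nn_integral_indicator cylinder_measurable[OF P])
    finally show ?case
      using law[OF set] by (simp add: mass_def)
  next
    case (mult u c)
    then show ?case
      by (simp add: push_scale push_nonneg ennreal_mult nn_integral_cmult
          coord[OF mult(2)] push_measurable_base)
  next
    case (add u v)
    then show ?case
      by (simp add: push_add push_nonneg ennreal_plus nn_integral_add
          coord[OF add(1)] coord[OF add(3)] push_measurable_base)
  next
    case (seq U)
    have inc: "U i x \<le> U j x" if "i \<le> j" for i j x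
      using \<open>incseq U\<close> that by (auto simp: incseq_def le_fun_def)
    have lim: "(\<lambda>i. U i x) \<longlonglongrightarrow> F x" for x
      using seq(4)[of x] by simp
    have "(\<lambda>i. \<integral>\<^sup>+\<omega>. ennreal (U i (\<omega> n)) \<partial>P) \<longlonglongrightarrow> (\<integral>\<^sup>+\<omega>. ennreal (F (\<omega> n)) \<partial>P)"
      by (intro nn_integral_LIMSEQ tendsto_ennrealI lim coord seq(1))
        (auto simp: incseq_def le_fun_def intro!: ennreal_leI inc)
    moreover have "(\<lambda>i. \<integral>\<^sup>+x. ennreal (push n (U i) x) \<partial>\<mu>) \<longlonglongrightarrow> (\<integral>\<^sup>+x. ennreal (push n F x) \<partial>\<mu>)"
      by (intro nn_integral_LIMSEQ tendsto_ennrealI push_tendsto lim push_measurable_base seq(1) F(1))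
        (auto simp: incseq_def le_fun_def intro!: ennreal_leI inc push_mono seq(1))
    ultimately show ?case
      unfolding seq(5) by (rule LIMSEQ_unique)
  qed
qed

lemma integral_coordinate:
  assumes P: "sets P = sets (solenoid_space \<sigma>)"
    and law: "\<And>B. B \<in> sets borel \<Longrightarrow> emeasure P (cylinder \<sigma> n B) = mass n B"
    and F[measurable]: "F \<in> borel_measurable borel"
    and int: "integrable P (\<lambda>\<omega>. F (\<omega> n))"
  shows "integrable \<mu> (push n F) \<and> (\<integral>\<omega>. F (\<omega> n) \<partial>P) = (\<integral>x. push n F x \<partial>\<mu>)"
proof -
  have nn: "(\<integral>\<^sup>+\<omega>. ennreal (G (\<omega> n)) \<partial>P) = (\<integral>\<^sup>+x. ennreal (push n G x) \<partial>\<mu>)"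
    if "G \<in> borel_measurable borel" "\<And>x. 0 \<le> G x" for G
    by (rule nn_integral_coordinate[OF P _ that]) (rule law)
  have nonneg_case: "integrable \<mu> (push n G) \<and> (\<integral>\<omega>. G (\<omega> n) \<partial>P) = (\<integral>x. push n G x \<partial>\<mu>)"
    if [measurable]: "G \<in> borel_measurable borel" and "\<And>x. 0 \<le> G x" and intG: "integrable P (\<lambda>\<omega>. G (\<omega> n))"
    for G
  proof
    have "(\<integral>\<^sup>+\<omega>. ennreal (G (\<omega> n)) \<partial>P) < \<infinity>"
      using intG that(2) by (simp add: nn_integral_eq_integral)
    then show "integrable \<mu> (push n G)"
      using nn[OF that(1,2)] by (intro integrableI_nonneg) (auto intro: push_nonneg that)
    show "(\<integral>\<omega>. G (\<omega> n) \<partial>P) = (\<integral>x. push n G x \<partial>\<mu>)"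
      using intG nn[OF that(1,2)] that(2)
      by (simp add: integral_eq_nn_integral push_nonneg borel_measurable_integrable)
  qed
  define G H where "G = (\<lambda>x. max 0 (F x))" and "H = (\<lambda>x. max 0 (- F x))"
  have [measurable]: "G \<in> borel_measurable borel" "H \<in> borel_measurable borel"
    by (simp_all add: G_def H_def)
  have FGH: "F x = G x - H x" for x by (simp add: G_def H_def)
  have intG: "integrable P (\<lambda>\<omega>. G (\<omega> n))" and intH: "integrable P (\<lambda>\<omega>. H (\<omega> n))"
    using int by (simp_all add: G_def H_def)
  note G = nonneg_case[OF _ _ intG] and H = nonneg_case[OF _ _ intH]
  have "push n (\<lambda>x. G x + (-1) * H x) = (\<lambda>x. push n G x + push n (\<lambda>x. (-1) * H x) x)"
    by (rule push_add) measurable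
  then have "push n F = (\<lambda>x. push n G x - push n H x)"
    using push_scale[of H n "-1"] by (simp add: FGH[abs_def])
  moreover have "(\<integral>\<omega>. F (\<omega> n) \<partial>P) = (\<integral>\<omega>. G (\<omega> n) \<partial>P) - (\<integral>\<omega>. H (\<omega> n) \<partial>P)"
    unfolding FGH by (rule Bochner_Integration.integral_diff[OF intG intH])
  moreover have "\<And>x. 0 \<le> G x" "\<And>x. 0 \<le> H x"
    by (simp_all add: G_def H_def)
  ultimately show ?thesis
    using G H by (simp add: Bochner_Integration.integral_diff)
qed

lemma path_measure_identity:
  assumes P: "sets P = sets (solenoid_space \<sigma>)"
    and law: "\<And>B. B \<in> sets borel \<Longrightarrow> emeasure P (cylinder \<sigma> n B) = mass n B"
    and f: "\<And>k. k \<le> n \<Longrightarrow> f k \<in> borel_measurable borel"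
  shows "path_space_identity R h \<mu> P n f"
proof -
  define F where "F = (\<lambda>y. \<Prod>k\<le>n. f k ((\<sigma> ^^ (n - k)) y))"
  have F: "F \<in> borel_measurable borel"
    unfolding F_def by (intro borel_measurable_prod measurable_compose[OF funpow_sigma_measurable f]) simp
  have space: "space P = solenoid \<sigma>"
    using sets_eq_imp_space_eq[OF P] by (simp add: space_solenoid_space)
  have L: "(\<Prod>k\<le>n. f k (\<omega> k)) = F (\<omega> n)" if "\<omega> \<in> space P" for \<omega>
    unfolding F_def
  proof (rule prod.cong[OF refl])
    fix k assume "k \<in> {..n}"
    then show "f k (\<omega> k) = f k ((\<sigma> ^^ (n - k)) (\<omega> n))"
      using solenoid_funpow[of \<omega> \<sigma> "n - k" k] that space by simp
  qed
  have S: "(\<lambda>x. f 0 x * nested_transfer R h (map f [1..<Suc n]) x) = push n F"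
    unfolding F_def by (intro ext nested_transfer_eq_push f)
  have "(\<integral>\<^sup>+\<omega>. ennreal (\<Prod>k\<le>n. f k (\<omega> k)) \<partial>P) = (\<integral>\<^sup>+x. ennreal (push n F x) \<partial>\<mu>)"
    if nonneg: "\<forall>k\<le>n. \<forall>x. 0 \<le> f k x"
  proof -
    have "0 \<le> F x" for x
      unfolding F_def using nonneg by (intro prod_nonneg) auto
    moreover have "(\<integral>\<^sup>+\<omega>. ennreal (\<Prod>k\<le>n. f k (\<omega> k)) \<partial>P) = (\<integral>\<^sup>+\<omega>. ennreal (F (\<omega> n)) \<partial>P)"
      by (intro nn_integral_cong) (simp add: L)
    ultimately show ?thesis
      using nn_integral_coordinate[OF P law F] by simp
  qed
  moreover have "integrable \<mu> (push n F) \<and> (\<integral>\<omega>. (\<Prod>k\<le>n. f k (\<omega> k)) \<partial>P) = (\<integral>x. push n F x \<partial>\<mu>)"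
    if "integrable P (\<lambda>\<omega>. \<Prod>k\<le>n. f k (\<omega> k))"
  proof -
    have "integrable P (\<lambda>\<omega>. F (\<omega> n))"
      using that by (simp add: L cong: Bochner_Integration.integrable_cong)
    moreover have "(\<integral>\<omega>. (\<Prod>k\<le>n. f k (\<omega> k)) \<partial>P) = (\<integral>\<omega>. F (\<omega> n) \<partial>P)"
      by (intro Bochner_Integration.integral_cong refl L)
    ultimately show ?thesis
      using integral_coordinate[OF P law F] by simp
  qed
  ultimately show ?thesis
    unfolding path_space_identity_def Let_def S by blast
qed

text \<open>
  Conversely, the identity for \<open>f n = indicator B\<close> and all other \<open>f k\<close> equal to 1 determines
  the law of the \<open>n\<close>-th coordinate.
\<close>

lemma identity_imp_coordinate_law:
  assumes P: "sets P = sets (solenoid_space \<sigma>)"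
    and id: "\<And>f. (\<forall>k\<le>n. f k \<in> borel_measurable borel) \<Longrightarrow> path_space_identity R h \<mu> P n f"
    and [measurable]: "B \<in> sets borel"
  shows "emeasure P (cylinder \<sigma> n B) = mass n B"
proof -
  define f :: "nat \<Rightarrow> 'a \<Rightarrow> real" where "f k = (if k = n then indicator B else (\<lambda>_. 1))" for k
  have space: "space P = solenoid \<sigma>"
    using sets_eq_imp_space_eq[OF P] by (simp add: space_solenoid_space)
  have f: "f k \<in> borel_measurable borel" for k
    unfolding f_def by simp
  have prod: "(\<Prod>k\<le>n. f k (z k)) = indicator B (z n)" for z
  proof -
    have "(\<Prod>k\<le>n. f k (z k)) = (\<Prod>k\<le>n. if k = n then indicator B (z k) else 1)"
      by (intro prod.cong) (auto simp: f_def)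
    then show ?thesis by simp
  qed
  have S: "f 0 x * nested_transfer R h (map f [1..<Suc n]) x = push n (indicator B) x" for x
    unfolding nested_transfer_eq_push[of n f x, OF f] prod by simp
  have "emeasure P (cylinder \<sigma> n B) = (\<integral>\<^sup>+\<omega>. indicator (cylinder \<sigma> n B) \<omega> \<partial>P)"
    by (intro nn_integral_indicator[symmetric]) (rule cylinder_measurable[OF P], measurable)
  also have "\<dots> = (\<integral>\<^sup>+\<omega>. ennreal (\<Prod>k\<le>n. f k (\<omega> k)) \<partial>P)"
    unfolding prod by (intro nn_integral_cong) (auto simp: space split: split_indicator)
  also have "\<dots> = (\<integral>\<^sup>+x. ennreal (f 0 x * nested_transfer R h (map f [1..<Suc n]) x) \<partial>\<mu>)"
    using id[of f] f unfolding path_space_identity_def Let_def by (auto simp: f_def)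
  also have "\<dots> = mass n B"
    unfolding S mass_def ..
  finally show ?thesis .
qed

text \<open>
  The cylinders are stable under intersection, since any two of them can be written over
  a common coordinate, so the coordinate laws alone determine the measure.
\<close>

lemma path_measure_unique:
  assumes P: "sets P = sets (solenoid_space \<sigma>)" and Q: "sets Q = sets (solenoid_space \<sigma>)"
    and lawP: "\<And>n B. B \<in> sets borel \<Longrightarrow> emeasure P (cylinder \<sigma> n B) = mass n B"
    and lawQ: "\<And>n B. B \<in> sets borel \<Longrightarrow> emeasure Q (cylinder \<sigma> n B) = mass n B"
  shows "P = Q"
proof (rule measure_eqI_generator_eq[where A="\<lambda>_. solenoid \<sigma>"])
  have "algebra (solenoid \<sigma>) (borel_cylinders \<sigma>)"
    by (rule algebra_borel_cylinders[OF sigma_measurable])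
  then have "\<forall>C\<in>borel_cylinders \<sigma>. \<forall>D\<in>borel_cylinders \<sigma>. C \<inter> D \<in> borel_cylinders \<sigma>"
    unfolding algebra_iff_Int by (elim conjE)
  then show "Int_stable (borel_cylinders \<sigma>)"
    by (simp only: Int_stable_def)
  show "borel_cylinders \<sigma> \<subseteq> Pow (solenoid \<sigma>)" by auto
  show "emeasure P C = emeasure Q C" if "C \<in> borel_cylinders \<sigma>" for C
  proof -
    from that have "\<exists>n B. C = cylinder \<sigma> n B \<and> B \<in> sets borel" by (rule CollectD)
    then show ?thesis using lawP lawQ by auto
  qed
  show "sets P = sigma_sets (solenoid \<sigma>) (borel_cylinders \<sigma>)"
    "sets Q = sigma_sets (solenoid \<sigma>) (borel_cylinders \<sigma>)"
    using P Q by (simp_all add: sets_solenoid_space)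
  show "range (\<lambda>_. solenoid \<sigma>) \<subseteq> borel_cylinders \<sigma>"
    by (auto intro!: exI[of _ "UNIV"])
  show "emeasure P (solenoid \<sigma>) \<noteq> \<infinity>"
    using lawP[of UNIV 0] by (simp add: mass_UNIV)
qed simp

theorem path_measure_exists_unique:
  "\<exists>!P. prob_space P \<and> sets P = sets (solenoid_space \<sigma>) \<and>
     (\<forall>n f. (\<forall>k\<le>n. f k \<in> borel_measurable borel) \<longrightarrow> path_space_identity R h \<mu> P n f)"
proof -
  obtain P where P: "sets P = sets (solenoid_space \<sigma>)"
    and law: "\<And>n B. B \<in> sets borel \<Longrightarrow> emeasure P (cylinder \<sigma> n B) = mass n B"
    using path_measure_exists by metis
  have "space P = solenoid \<sigma>"
    using sets_eq_imp_space_eq[OF P] by (simp add: space_solenoid_space)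
  then have "prob_space P"
    using law[of UNIV 0] by (intro prob_spaceI) (simp add: mass_UNIV)
  show ?thesis
  proof (rule ex1I[of _ P], intro conjI allI impI)
    show "path_space_identity R h \<mu> P n f" if "\<forall>k\<le>n. f k \<in> borel_measurable borel" for n f
      using that by (intro path_measure_identity P law) auto
  next
    fix Q assume Q: "prob_space Q \<and> sets Q = sets (solenoid_space \<sigma>) \<and>
       (\<forall>n f. (\<forall>k\<le>n. f k \<in> borel_measurable borel) \<longrightarrow> path_space_identity R h \<mu> Q n f)"
    show "Q = P"
    proof (rule path_measure_unique[OF _ P])
      show "emeasure Q (cylinder \<sigma> n B) = mass n B" if "B \<in> sets borel" for n B
        using Q that by (intro identity_imp_coordinate_law) auto
    qed (use Q law in auto)
  qed (fact \<open>prob_space P\<close> P)+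
qed

end

theorem theorem3p9:
  fixes \<sigma> :: "'a::t2_space \<Rightarrow> 'a"
    and R :: "('a \<Rightarrow> real) \<Rightarrow> ('a \<Rightarrow> real)"
    and \<mu> :: "'a measure"
    and h :: "'a \<Rightarrow> real"
  assumes "locally_compact_space (euclidean :: 'a topology)"
    and "\<sigma> \<in> measurable borel borel" and "surj \<sigma>"
    and "transfer_operator \<sigma> R"
    and "prob_space \<mu>" and "sets \<mu> = sets borel"
    and "h \<in> borel_measurable borel" and "\<And>x. 0 \<le> h x"
    and "(\<integral>x. h x \<partial>\<mu>) = 1"
    and "R h = h"
  shows "\<exists>!P. prob_space P \<and> sets P = sets (solenoid_space \<sigma>) \<and>
           (\<forall>n f. (\<forall>k\<le>n. f k \<in> borel_measurable borel) \<longrightarrow> path_space_identity R h \<mu> P n f)"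
proof -
  interpret prob_space \<mu> by fact
  have "integrable \<mu> h"
    using assms(9) not_integrable_integral_eq[of \<mu> h] by (cases "integrable \<mu> h") auto
  then have "(\<integral>\<^sup>+x. ennreal (h x) \<partial>\<mu>) = 1"
    using assms(8,9) by (simp add: nn_integral_eq_integral)
  with assms(2-4,6-8,10) interpret harmonic_transfer \<sigma> R h \<mu>
    by (rule harmonic_transfer.intro)
  show ?thesis by (rule path_measure_exists_unique)
qed

end
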